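(* $A_{0}+AP_{+}$ is not a pre-Bezout domain.
   Context: $\mathbb{C}_{\geq 0}=\{s\in\mathbb{C}:\operatorname{Re}(s)\geq 0\}$ and $\mathbb{C}_{>0}=\{s\in\mathbb{C}:\operatorname{Re}(s)>0\}$. $A_{0}$ is the set of functions $f:\mathbb{C}_{\geq 0}\to\mathbb{C}$ that are holomorphic in $\mathbb{C}_{>0}$, continuous on $\mathbb{C}_{\geq 0}$, and satisfy $\lim_{s\to\infty}f(s)=0$ (limit as $|s|\to\infty$ in $\mathbb{C}_{\geq 0}$). $AP_{+}$ (causal almost periodic functions) is the closure, in the supremum norm on $\mathbb{C}_{\geq 0}$, of the complex linear span of the functions $s\mapsto e^{-st}$, $t\geq 0$. $A_{0}+AP_{+}=\{f:\mathbb{C}_{\geq 0}\to\mathbb{C}: f=f_{A_0}+f_{AP_+},\ f_{A_0}\in A_0,\ f_{AP_+}\in AP_+\}$ is a Banach algebra with pointwise operations and the supremum norm; it is an integral domain. Let $R$ be an integral domain (a commutative unital ring with no zero divisors). An element $d\in R$ is a greatest common divisor (gcd) of $a,b\in R$ if $d$ divides $a$ and $b$ and every common divisor $k$ of $a$ and $b$ divides $d$. $R$ is a pre-Bezout domain if for every $a,b\in R$ for which there exists a gcd $d$, there exist $x,y\in R$ such that $d=xa+yb$. *)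

theory Defs
  imports "HOL-Complex_Analysis.Complex_Analysis" "HOL-Algebra.Divisibility" "HOL-Algebra.Ring"
begin

definition closed_rhp :: "complex set" where
  "closed_rhp = {s. Re s \<ge> 0}"

definition open_rhp :: "complex set" where
  "open_rhp = {s. Re s > 0}"

text \<open>A function from the closed right half-plane to the complex numbers is represented by an
  element of \<^term>\<open>extensional closed_rhp\<close>, so that equality of representatives is equality on
  \<^term>\<open>closed_rhp\<close>.\<close>

definition A0 :: "(complex \<Rightarrow> complex) set" where
  "A0 = {f \<in> extensional closed_rhp. f holomorphic_on open_rhp \<and> continuous_on closed_rhp f \<and>
           (f \<longlongrightarrow> 0) (inf at_infinity (principal closed_rhp))}"

definition exp_span :: "(complex \<Rightarrow> complex) set" where
  "exp_span = {\<lambda>s\<in>closed_rhp. \<Sum>t\<in>T. c t * exp (- (s * complex_of_real t)) |T c.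
                 finite T \<and> T \<subseteq> {0..}}"

text \<open>Members of \<^term>\<open>exp_span\<close> are bounded, so any function within finite distance of one is
  bounded too and the closure need not be restricted to bounded functions explicitly.\<close>

definition AP_plus :: "(complex \<Rightarrow> complex) set" where
  "AP_plus = {f \<in> extensional closed_rhp.
                \<forall>e>0. \<exists>g\<in>exp_span. \<forall>s\<in>closed_rhp. cmod (f s - g s) \<le> e}"

definition A0_AP_plus :: "(complex \<Rightarrow> complex) ring" where
  "A0_AP_plus =
     \<lparr>carrier = {\<lambda>s\<in>closed_rhp. f s + g s |f g. f \<in> A0 \<and> g \<in> AP_plus},
      mult = (\<lambda>f g. \<lambda>s\<in>closed_rhp. f s * g s),
      one = (\<lambda>s\<in>closed_rhp. 1),
      zero = (\<lambda>s\<in>closed_rhp. 0),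
      add = (\<lambda>f g. \<lambda>s\<in>closed_rhp. f s + g s)\<rparr>"

locale pre_bezout_domain = domain R for R (structure) +
  assumes bezout:
    "\<lbrakk>a \<in> carrier R; b \<in> carrier R; d \<in> carrier R; d gcdof a b\<rbrakk>
      \<Longrightarrow> \<exists>x\<in>carrier R. \<exists>y\<in>carrier R. d = x \<otimes> a \<oplus> y \<otimes> b"

text \<open>The rest of this theory shows that \<^term>\<open>A0_AP_plus\<close> is an integral domain, so it can
  fail to be a pre-Bezout domain only through the Bezout condition.\<close>

lemma open_rhp_subset: "open_rhp \<subseteq> closed_rhp"
  by (auto simp: open_rhp_def closed_rhp_def)

lemma open_open_rhp: "open open_rhp"
  unfolding open_rhp_def by (rule open_halfspace_Re_gt)

lemma connected_open_rhp: "connected open_rhp"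
  unfolding open_rhp_def by (intro convex_connected convex_halfspace_Re_gt)

lemma holomorphic_restrict:
  "restrict f closed_rhp holomorphic_on open_rhp \<longleftrightarrow> f holomorphic_on open_rhp"
  by (rule holomorphic_cong) (use open_rhp_subset in auto)

lemma continuous_restrict:
  "continuous_on closed_rhp (restrict f closed_rhp) \<longleftrightarrow> continuous_on closed_rhp f"
  by (rule continuous_on_cong) auto

lemma tendsto_restrict:
  "(restrict f closed_rhp \<longlongrightarrow> 0) (inf at_infinity (principal closed_rhp)) \<longleftrightarrow>
   (f \<longlongrightarrow> 0) (inf at_infinity (principal closed_rhp))"
  by (rule tendsto_cong) (auto simp: eventually_inf_principal)

lemma A0_restrictI:
  assumes "f holomorphic_on open_rhp" "continuous_on closed_rhp f"
    "(f \<longlongrightarrow> 0) (inf at_infinity (principal closed_rhp))"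
  shows "restrict f closed_rhp \<in> A0"
  using assms by (simp add: A0_def holomorphic_restrict continuous_restrict tendsto_restrict)

lemma A0_D:
  assumes "f \<in> A0"
  shows "f \<in> extensional closed_rhp" "f holomorphic_on open_rhp" "continuous_on closed_rhp f"
    "(f \<longlongrightarrow> 0) (inf at_infinity (principal closed_rhp))"
  using assms by (auto simp: A0_def)

lemma A0_zero: "(\<lambda>s\<in>closed_rhp. 0) \<in> A0"
  by (rule A0_restrictI) auto

lemma A0_add: "f \<in> A0 \<Longrightarrow> g \<in> A0 \<Longrightarrow> (\<lambda>s\<in>closed_rhp. f s + g s) \<in> A0"
  by (rule A0_restrictI)
    (auto intro!: holomorphic_intros continuous_intros tendsto_add_zero dest: A0_D)

lemma A0_mult: "f \<in> A0 \<Longrightarrow> g \<in> A0 \<Longrightarrow> (\<lambda>s\<in>closed_rhp. f s * g s) \<in> A0"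
  by (rule A0_restrictI)
    (auto intro!: holomorphic_intros continuous_intros tendsto_mult_zero dest: A0_D)

lemma exp_span_D:
  assumes "g \<in> exp_span"
  shows "g holomorphic_on open_rhp" "continuous_on closed_rhp g"
    "\<exists>B. \<forall>s\<in>closed_rhp. cmod (g s) \<le> B"
proof -
  from assms obtain T c where T: "finite T" "T \<subseteq> {0..}"
    and g: "g = (\<lambda>s\<in>closed_rhp. \<Sum>t\<in>T. c t * exp (- (s * complex_of_real t)))"
    by (auto simp: exp_span_def)
  show "g holomorphic_on open_rhp"
    unfolding g holomorphic_restrict by (intro holomorphic_intros)
  show "continuous_on closed_rhp g"
    unfolding g continuous_restrict by (intro continuous_intros)
  have "cmod (g s) \<le> (\<Sum>t\<in>T. cmod (c t))" if s: "s \<in> closed_rhp" for s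
  proof -
    have "cmod (c t * exp (- (s * complex_of_real t))) \<le> cmod (c t)" if "t \<in> T" for t
    proof -
      have "0 \<le> Re s * t"
        using s that T by (intro mult_nonneg_nonneg) (auto simp: closed_rhp_def)
      then have "cmod (exp (- (s * complex_of_real t))) \<le> 1"
        by simp
      then show ?thesis
        by (simp add: norm_mult mult_left_le del: norm_exp_eq_Re)
    qed
    then show ?thesis
      using s by (simp add: g sum_norm_le)
  qed
  then show "\<exists>B. \<forall>s\<in>closed_rhp. cmod (g s) \<le> B"
    by blast
qed

lemma exp_span_monomial:
  assumes "t \<ge> 0"
  shows "(\<lambda>s\<in>closed_rhp. c * exp (- (s * complex_of_real t))) \<in> exp_span"
  unfolding exp_span_def using assms
  by (intro CollectI exI[of _ "{t}"] exI[of _ "\<lambda>_. c"]) auto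

lemma exp_span_zero: "(\<lambda>s\<in>closed_rhp. 0) \<in> exp_span"
  unfolding exp_span_def by (intro CollectI exI[of _ "{}"]) auto

lemma exp_span_add:
  assumes "f \<in> exp_span" "g \<in> exp_span"
  shows "(\<lambda>s\<in>closed_rhp. f s + g s) \<in> exp_span"
proof -
  from assms obtain T c U d where T: "finite T" "T \<subseteq> {0..}" and U: "finite U" "U \<subseteq> {0..}"
    and f: "f = (\<lambda>s\<in>closed_rhp. \<Sum>t\<in>T. c t * exp (- (s * complex_of_real t)))"
    and g: "g = (\<lambda>s\<in>closed_rhp. \<Sum>t\<in>U. d t * exp (- (s * complex_of_real t)))"
    by (auto simp: exp_span_def)
  define k where "k t = (if t \<in> T then c t else 0) + (if t \<in> U then d t else 0)" for t
  have "(\<Sum>t\<in>T \<union> U. k t * exp (- (s * complex_of_real t))) =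
        (\<Sum>t\<in>T. c t * exp (- (s * complex_of_real t))) +
        (\<Sum>t\<in>U. d t * exp (- (s * complex_of_real t)))" for s
  proof -
    have 1: "(\<Sum>t\<in>T. c t * exp (- (s * complex_of_real t))) =
        (\<Sum>t\<in>T \<union> U. (if t \<in> T then c t else 0) * exp (- (s * complex_of_real t)))"
      by (rule sum.mono_neutral_cong_left) (use T U in auto)
    have 2: "(\<Sum>t\<in>U. d t * exp (- (s * complex_of_real t))) =
        (\<Sum>t\<in>T \<union> U. (if t \<in> U then d t else 0) * exp (- (s * complex_of_real t)))"
      by (rule sum.mono_neutral_cong_left) (use T U in auto)
    show ?thesis
      unfolding 1 2 k_def by (simp only: distrib_right sum.distrib)
  qed
  then show ?thesis
    unfolding exp_span_def using T U
    by (intro CollectI exI[of _ "T \<union> U"] exI[of _ k]) (auto simp: f g restrict_def fun_eq_iff)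
qed

lemma exp_span_sum:
  assumes "finite I" "\<And>i. i \<in> I \<Longrightarrow> restrict (f i) closed_rhp \<in> exp_span"
  shows "(\<lambda>s\<in>closed_rhp. \<Sum>i\<in>I. f i s) \<in> exp_span"
  using assms
proof (induction I rule: finite_induct)
  case empty
  then show ?case by (simp only: sum.empty exp_span_zero)
next
  case (insert i I)
  have "(\<lambda>s\<in>closed_rhp. \<Sum>j\<in>insert i I. f j s) =
        (\<lambda>s\<in>closed_rhp. restrict (f i) closed_rhp s +
                             (\<lambda>s\<in>closed_rhp. \<Sum>j\<in>I. f j s) s)"
    using insert.hyps by (auto simp: fun_eq_iff restrict_def)
  also have "\<dots> \<in> exp_span"
    using insert by (intro exp_span_add) auto
  finally show ?case .
qed

lemma exp_span_mult:
  assumes "f \<in> exp_span" "g \<in> exp_span"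
  shows "(\<lambda>s\<in>closed_rhp. f s * g s) \<in> exp_span"
proof -
  from assms obtain T c U d where T: "finite T" "T \<subseteq> {0..}" and U: "finite U" "U \<subseteq> {0..}"
    and f: "f = (\<lambda>s\<in>closed_rhp. \<Sum>t\<in>T. c t * exp (- (s * complex_of_real t)))"
    and g: "g = (\<lambda>s\<in>closed_rhp. \<Sum>t\<in>U. d t * exp (- (s * complex_of_real t)))"
    by (auto simp: exp_span_def)
  have "(\<lambda>s\<in>closed_rhp. f s * g s) =
    (\<lambda>s\<in>closed_rhp. \<Sum>t\<in>T. \<Sum>u\<in>U. (c t * d u) * exp (- (s * complex_of_real (t + u))))"
    by (rule restrict_ext)
      (simp add: f g sum_product ring_distribs mult_exp_exp [symmetric] exp_add exp_diff exp_minus field_simps)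
  also have "\<dots> \<in> exp_span"
    using T U by (intro exp_span_sum exp_span_monomial) (auto simp: subset_iff)
  finally show ?thesis .
qed

lemma exp_span_subset_AP: "exp_span \<subseteq> AP_plus"
proof
  fix g assume g: "g \<in> exp_span"
  then have "g \<in> extensional closed_rhp"
    by (auto simp: exp_span_def)
  then show "g \<in> AP_plus"
    using g by (auto simp: AP_plus_def intro!: bexI[of _ g])
qed

lemma AP_D:
  assumes "f \<in> AP_plus"
  shows "f holomorphic_on open_rhp" "continuous_on closed_rhp f"
    "\<exists>B. \<forall>s\<in>closed_rhp. cmod (f s) \<le> B"
proof -
  have "\<exists>g\<in>exp_span. \<forall>s\<in>closed_rhp. cmod (f s - g s) \<le> inverse (real (Suc n))" for n
    using assms by (auto simp: AP_plus_def)
  then obtain g where g: "\<And>n. g n \<in> exp_span"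
    "\<And>n s. s \<in> closed_rhp \<Longrightarrow> cmod (f s - g n s) \<le> inverse (real (Suc n))"
    by metis
  have lim: "uniform_limit closed_rhp g f sequentially"
  proof (rule uniform_limitI)
    fix e :: real assume "e > 0"
    then have "\<forall>\<^sub>F n in sequentially. inverse (real (Suc n)) < e"
      using LIMSEQ_inverse_real_of_nat order_tendstoD(2) by blast
    then show "\<forall>\<^sub>F n in sequentially. \<forall>s\<in>closed_rhp. dist (g n s) (f s) < e"
      by eventually_elim (metis dist_norm g(2) norm_minus_commute order_le_less_trans)
  qed
  show "continuous_on closed_rhp f"
    by (rule uniform_limit_theorem[OF _ lim]) (auto intro!: always_eventually exp_span_D g)
  show "f holomorphic_on open_rhp"
  proof (rule holomorphic_uniform_sequence[OF open_open_rhp])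
    show "g n holomorphic_on open_rhp" for n
      by (intro exp_span_D g)
    fix x assume "x \<in> open_rhp"
    then obtain d where "d > 0" "cball x d \<subseteq> open_rhp"
      using open_open_rhp open_contains_cball by blast
    then show "\<exists>d>0. cball x d \<subseteq> open_rhp \<and> uniform_limit (cball x d) g f sequentially"
      using lim open_rhp_subset by (meson order_trans uniform_limit_on_subset)
  qed
  obtain B where B: "\<forall>s\<in>closed_rhp. cmod (g 0 s) \<le> B"
    using exp_span_D(3)[OF g(1)] by blast
  have "cmod (f s) \<le> B + 1" if "s \<in> closed_rhp" for s
    using B g(2)[OF that, of 0] that norm_triangle_sub[of "f s" "g 0 s"] by fastforce
  then show "\<exists>B. \<forall>s\<in>closed_rhp. cmod (f s) \<le> B"
    by blast
qed

lemma AP_add: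
  assumes "f \<in> AP_plus" "g \<in> AP_plus"
  shows "(\<lambda>s\<in>closed_rhp. f s + g s) \<in> AP_plus"
  unfolding AP_plus_def
proof (intro CollectI conjI allI impI restrict_extensional)
  fix e :: real assume "e > 0"
  then have e2: "e / 2 > 0" by simp
  obtain p where p: "p \<in> exp_span" "\<forall>s\<in>closed_rhp. cmod (f s - p s) \<le> e / 2"
    using assms(1) e2 unfolding AP_plus_def by blast
  obtain q where q: "q \<in> exp_span" "\<forall>s\<in>closed_rhp. cmod (g s - q s) \<le> e / 2"
    using assms(2) e2 unfolding AP_plus_def by blast
  have "cmod (f s + g s - (p s + q s)) \<le> e" if "s \<in> closed_rhp" for s
    using norm_triangle_mono[of "f s - p s" "e / 2" "g s - q s" "e / 2"] p q that
    by (simp add: algebra_simps)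
  then show "\<exists>h\<in>exp_span. \<forall>s\<in>closed_rhp. cmod ((\<lambda>s\<in>closed_rhp. f s + g s) s - h s) \<le> e"
    using exp_span_add[OF p(1) q(1)] by (intro bexI) auto
qed

lemma AP_mult:
  assumes "f \<in> AP_plus" "g \<in> AP_plus"
  shows "(\<lambda>s\<in>closed_rhp. f s * g s) \<in> AP_plus"
  unfolding AP_plus_def
proof (intro CollectI conjI allI impI restrict_extensional)
  fix e :: real assume e: "e > 0"
  obtain B where B: "\<forall>s\<in>closed_rhp. cmod (g s) \<le> B"
    using AP_D(3)[OF assms(2)] by blast
  define B' where "B' = max B 1"
  have B': "B' > 0" "\<forall>s\<in>closed_rhp. cmod (g s) \<le> B'"
    using B by (auto simp: B'_def max.coboundedI1)
  have "e / 2 / B' > 0" using e B' by simp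
  obtain p where p: "p \<in> exp_span" "\<forall>s\<in>closed_rhp. cmod (f s - p s) \<le> e / 2 / B'"
    using assms(1) \<open>e / 2 / B' > 0\<close> unfolding AP_plus_def by blast
  obtain C where C: "\<forall>s\<in>closed_rhp. cmod (p s) \<le> C"
    using exp_span_D(3)[OF p(1)] by blast
  define C' where "C' = max C 1"
  have C': "C' > 0" "\<forall>s\<in>closed_rhp. cmod (p s) \<le> C'"
    using C by (auto simp: C'_def max.coboundedI1)
  have "e / 2 / C' > 0" using e C' by simp
  obtain q where q: "q \<in> exp_span" "\<forall>s\<in>closed_rhp. cmod (g s - q s) \<le> e / 2 / C'"
    using assms(2) \<open>e / 2 / C' > 0\<close> unfolding AP_plus_def by blast
  have "cmod (f s * g s - p s * q s) \<le> e" if s: "s \<in> closed_rhp" for s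
  proof -
    have "f s * g s - p s * q s = (f s - p s) * g s + p s * (g s - q s)"
      by (simp add: algebra_simps)
    also have "cmod \<dots> \<le> cmod (f s - p s) * cmod (g s) + cmod (p s) * cmod (g s - q s)"
      by (metis norm_mult norm_triangle_ineq)
    also have "\<dots> \<le> e / 2 / B' * B' + C' * (e / 2 / C')"
      using p(2) q(2) B' C' s e by (intro add_mono mult_mono) auto
    also have "\<dots> = e"
      using B' C' by simp
    finally show ?thesis .
  qed
  then show "\<exists>h\<in>exp_span. \<forall>s\<in>closed_rhp. cmod ((\<lambda>s\<in>closed_rhp. f s * g s) s - h s) \<le> e"
    using exp_span_mult[OF p(1) q(1)] by (intro bexI) auto
qed

lemma AP_const: "(\<lambda>s\<in>closed_rhp. c) \<in> AP_plus"
  using exp_span_monomial[of 0 c] exp_span_subset_AP by auto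

lemma A0_AP_mult:
  assumes f: "f \<in> A0" and g: "g \<in> AP_plus"
  shows "(\<lambda>s\<in>closed_rhp. f s * g s) \<in> A0"
proof (rule A0_restrictI)
  show "(\<lambda>s. f s * g s) holomorphic_on open_rhp" "continuous_on closed_rhp (\<lambda>s. f s * g s)"
    using A0_D[OF f] AP_D[OF g] by (auto intro!: holomorphic_intros continuous_intros)
  obtain B where B: "\<forall>s\<in>closed_rhp. cmod (g s) \<le> B"
    using AP_D(3)[OF g] by blast
  show "((\<lambda>s. f s * g s) \<longlongrightarrow> 0) (inf at_infinity (principal closed_rhp))"
  proof (rule Lim_null_comparison)
    show "\<forall>\<^sub>F s in inf at_infinity (principal closed_rhp). norm (f s * g s) \<le> cmod (f s) * B"
      using B by (auto simp: eventually_inf_principal norm_mult intro!: always_eventually mult_left_mono)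
    show "((\<lambda>s. cmod (f s) * B) \<longlongrightarrow> 0) (inf at_infinity (principal closed_rhp))"
      using A0_D(4)[OF f] by (intro tendsto_mult_left_zero tendsto_norm_zero)
  qed
qed

lemma carrier_A0_AP_plus_iff:
  "h \<in> carrier A0_AP_plus \<longleftrightarrow>
     (\<exists>f\<in>A0. \<exists>g\<in>AP_plus. h = (\<lambda>s\<in>closed_rhp. f s + g s))"
  by (auto simp: A0_AP_plus_def)

lemma carrier_D:
  assumes "h \<in> carrier A0_AP_plus"
  shows "h \<in> extensional closed_rhp" "h holomorphic_on open_rhp" "continuous_on closed_rhp h"
proof -
  from assms obtain f g where fg: "f \<in> A0" "g \<in> AP_plus" and h: "h = (\<lambda>s\<in>closed_rhp. f s + g s)"
    by (auto simp: carrier_A0_AP_plus_iff)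
  show "h \<in> extensional closed_rhp" by (simp add: h)
  show "h holomorphic_on open_rhp"
    unfolding h holomorphic_restrict
    using A0_D[OF fg(1)] AP_D[OF fg(2)] by (intro holomorphic_intros)
  show "continuous_on closed_rhp h"
    unfolding h continuous_restrict
    using A0_D[OF fg(1)] AP_D[OF fg(2)] by (intro continuous_intros)
qed

lemma AP_subset_carrier: "AP_plus \<subseteq> carrier A0_AP_plus"
proof
  fix g assume g: "g \<in> AP_plus"
  then have "g = (\<lambda>s\<in>closed_rhp. (\<lambda>s\<in>closed_rhp. 0) s + g s)"
    by (auto simp: AP_plus_def fun_eq_iff extensional_def)
  then show "g \<in> carrier A0_AP_plus"
    unfolding carrier_A0_AP_plus_iff using g A0_zero by blast
qed

lemma carrier_add:
  assumes "h \<in> carrier A0_AP_plus" "k \<in> carrier A0_AP_plus"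
  shows "(\<lambda>s\<in>closed_rhp. h s + k s) \<in> carrier A0_AP_plus"
proof -
  from assms obtain f g f' g' where fg: "f \<in> A0" "g \<in> AP_plus" "f' \<in> A0" "g' \<in> AP_plus"
    and h: "h = (\<lambda>s\<in>closed_rhp. f s + g s)" and k: "k = (\<lambda>s\<in>closed_rhp. f' s + g' s)"
    unfolding carrier_A0_AP_plus_iff by blast
  have "(\<lambda>s\<in>closed_rhp. h s + k s) =
    (\<lambda>s\<in>closed_rhp. (\<lambda>s\<in>closed_rhp. f s + f' s) s + (\<lambda>s\<in>closed_rhp. g s + g' s) s)"
    by (rule restrict_ext) (simp add: h k algebra_simps)
  then show ?thesis
    unfolding carrier_A0_AP_plus_iff using A0_add AP_add fg by blast
qed

lemma carrier_mult:
  assumes "h \<in> carrier A0_AP_plus" "k \<in> carrier A0_AP_plus"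
  shows "(\<lambda>s\<in>closed_rhp. h s * k s) \<in> carrier A0_AP_plus"
proof -
  from assms obtain f g f' g' where fg: "f \<in> A0" "g \<in> AP_plus" "f' \<in> A0" "g' \<in> AP_plus"
    and h: "h = (\<lambda>s\<in>closed_rhp. f s + g s)" and k: "k = (\<lambda>s\<in>closed_rhp. f' s + g' s)"
    unfolding carrier_A0_AP_plus_iff by blast
  define u where "u = (\<lambda>s\<in>closed_rhp. (\<lambda>s\<in>closed_rhp. f s * f' s) s +
    (\<lambda>s\<in>closed_rhp. (\<lambda>s\<in>closed_rhp. f s * g' s) s + (\<lambda>s\<in>closed_rhp. f' s * g s) s) s)"
  have "u \<in> A0"
    unfolding u_def using fg by (intro A0_add A0_mult A0_AP_mult)
  moreover have "(\<lambda>s\<in>closed_rhp. h s * k s) =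
    (\<lambda>s\<in>closed_rhp. u s + (\<lambda>s\<in>closed_rhp. g s * g' s) s)"
    by (rule restrict_ext) (simp add: u_def h k algebra_simps)
  ultimately show ?thesis
    unfolding carrier_A0_AP_plus_iff using AP_mult fg by blast
qed

lemma carrier_integral:
  assumes h: "h \<in> carrier A0_AP_plus" and k: "k \<in> carrier A0_AP_plus"
    and hk: "(\<lambda>s\<in>closed_rhp. h s * k s) = (\<lambda>s\<in>closed_rhp. 0)"
  shows "h = (\<lambda>s\<in>closed_rhp. 0) \<or> k = (\<lambda>s\<in>closed_rhp. 0)"
proof -
  have 0: "h s * k s = 0" if "s \<in> closed_rhp" for s
    using fun_cong[OF hk, of s] that by simp
  have closure: "closure open_rhp = closed_rhp"
    using closure_halfspace_gt[of "1 :: complex" 0]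
    by (simp add: closed_rhp_def open_rhp_def inner_complex_def)
  have vanish: "f = (\<lambda>s\<in>closed_rhp. 0)"
    if f: "f \<in> carrier A0_AP_plus" and z: "\<And>s. s \<in> open_rhp \<Longrightarrow> f s = 0" for f
  proof -
    have "f s = 0" if "s \<in> closed_rhp" for s
    proof -
      have "continuous_on (closure open_rhp) f"
        using carrier_D(3)[OF f] closure by simp
      then show ?thesis
        by (rule continuous_constant_on_closure) (use z closure that in auto)
    qed
    then show ?thesis
      using carrier_D(1)[OF f] by (auto simp: fun_eq_iff extensional_def)
  qed
  show ?thesis
  proof (cases "\<forall>s\<in>open_rhp. h s = 0")
    case True
    then show ?thesis by (intro disjI1 vanish[OF h]) blast
  next
    case False
    then obtain w where w: "w \<in> open_rhp" "h w \<noteq> 0" by blast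
    define U where "U = open_rhp \<inter> h -` (- {0})"
    have "continuous_on open_rhp h"
      using carrier_D(3)[OF h] open_rhp_subset continuous_on_subset by blast
    then have "open U"
      unfolding U_def by (rule continuous_open_preimage[OF _ open_open_rhp]) auto
    moreover have "w \<in> U"
      using w by (simp add: U_def)
    ultimately have "w islimpt U"
      by (intro interior_limit_point) (simp add: interior_open)
    moreover have "k s = 0" if "s \<in> U" for s
      using that 0[of s] open_rhp_subset by (auto simp: U_def)
    moreover have "U \<subseteq> open_rhp"
      by (auto simp: U_def)
    ultimately have "k s = 0" if "s \<in> open_rhp" for s
      by (intro analytic_continuation[OF carrier_D(2)[OF k] open_open_rhp connected_open_rhp,
            of U w s]) (use w that in auto)
    then show ?thesis by (intro disjI2 vanish[OF k])
  qed
qed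

lemma domain_A0_AP_plus: "domain A0_AP_plus"
proof -
  have const_in: "(\<lambda>s\<in>closed_rhp. c) \<in> carrier A0_AP_plus" for c
    using AP_const AP_subset_carrier by blast
  have simps: "x \<oplus>\<^bsub>A0_AP_plus\<^esub> y = (\<lambda>s\<in>closed_rhp. x s + y s)"
    "x \<otimes>\<^bsub>A0_AP_plus\<^esub> y = (\<lambda>s\<in>closed_rhp. x s * y s)"
    "\<zero>\<^bsub>A0_AP_plus\<^esub> = (\<lambda>s\<in>closed_rhp. 0)" "\<one>\<^bsub>A0_AP_plus\<^esub> = (\<lambda>s\<in>closed_rhp. 1)" for x y
    by (simp_all add: A0_AP_plus_def)
  have "abelian_group A0_AP_plus"
  proof (rule abelian_groupI, unfold simps)
    fix x y z assume x: "x \<in> carrier A0_AP_plus" and y: "y \<in> carrier A0_AP_plus"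
    show "(\<lambda>s\<in>closed_rhp. x s + y s) \<in> carrier A0_AP_plus"
      by (rule carrier_add[OF x y])
    show "(\<lambda>s\<in>closed_rhp. (\<lambda>s\<in>closed_rhp. x s + y s) s + z s) =
          (\<lambda>s\<in>closed_rhp. x s + (\<lambda>s\<in>closed_rhp. y s + z s) s)"
      by (rule restrict_ext) (simp add: add.assoc)
    show "(\<lambda>s\<in>closed_rhp. x s + y s) = (\<lambda>s\<in>closed_rhp. y s + x s)"
      by (rule restrict_ext) (simp add: add.commute)
    show "(\<lambda>s\<in>closed_rhp. (\<lambda>s\<in>closed_rhp. 0) s + x s) = x"
      by (rule extensionalityI[OF restrict_extensional carrier_D(1)[OF x]]) simp
    have "(\<lambda>s\<in>closed_rhp. (\<lambda>s\<in>closed_rhp. (\<lambda>s\<in>closed_rhp. - 1) s * x s) s + x s) =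
          (\<lambda>s\<in>closed_rhp. 0)"
      by (rule restrict_ext) simp
    then show "\<exists>y\<in>carrier A0_AP_plus. (\<lambda>s\<in>closed_rhp. y s + x s) = (\<lambda>s\<in>closed_rhp. 0)"
      using carrier_mult[OF const_in x] by blast
  qed (rule const_in)
  moreover have "comm_monoid A0_AP_plus"
  proof (rule comm_monoidI, unfold simps)
    fix x y z assume x: "x \<in> carrier A0_AP_plus" and y: "y \<in> carrier A0_AP_plus"
    show "(\<lambda>s\<in>closed_rhp. x s * y s) \<in> carrier A0_AP_plus"
      by (rule carrier_mult[OF x y])
    show "(\<lambda>s\<in>closed_rhp. (\<lambda>s\<in>closed_rhp. x s * y s) s * z s) =
          (\<lambda>s\<in>closed_rhp. x s * (\<lambda>s\<in>closed_rhp. y s * z s) s)"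
      by (rule restrict_ext) (simp add: mult.assoc)
    show "(\<lambda>s\<in>closed_rhp. x s * y s) = (\<lambda>s\<in>closed_rhp. y s * x s)"
      by (rule restrict_ext) (simp add: mult.commute)
    show "(\<lambda>s\<in>closed_rhp. (\<lambda>s\<in>closed_rhp. 1) s * x s) = x"
      by (rule extensionalityI[OF restrict_extensional carrier_D(1)[OF x]]) simp
  qed (rule const_in)
  ultimately have "cring A0_AP_plus"
  proof (rule cringI, unfold simps)
    fix x y z :: "complex \<Rightarrow> complex"
    show "(\<lambda>s\<in>closed_rhp. (\<lambda>s\<in>closed_rhp. x s + y s) s * z s) =
          (\<lambda>s\<in>closed_rhp. (\<lambda>s\<in>closed_rhp. x s * z s) s + (\<lambda>s\<in>closed_rhp. y s * z s) s)"
      by (rule restrict_ext) (simp add: distrib_right)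
  qed
  moreover have "\<one>\<^bsub>A0_AP_plus\<^esub> \<noteq> \<zero>\<^bsub>A0_AP_plus\<^esub>"
    by (auto simp: simps fun_eq_iff closed_rhp_def intro!: exI[of _ 0])
  ultimately show ?thesis
    unfolding domain_def domain_axioms_def simps by (intro conjI allI impI carrier_integral)
qed

end

theory Submission
  imports Defs "HOL-Real_Asymp.Real_Asymp"
begin

text \<open>
  The failure is witnessed by \<open>a(s) = 1 / (1 + s)\<close> and \<open>b(s) = exp (-s)\<close>. Both tend to \<open>0\<close> as
  \<open>s \<rightarrow> +\<infinity>\<close> along the real axis, and elements of the ring are bounded, so \<open>x a + y b = 1\<close> is
  impossible. Yet \<open>1\<close> is a gcd of \<open>a\<close> and \<open>b\<close>: every common divisor \<open>k\<close> is a unit.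

  To see this, write \<open>k n = a\<close> and \<open>k m = b\<close>. The second equation shows that \<open>k\<close> has no zeros and
  that \<open>1/k = m exp s\<close> is bounded on the imaginary axis; the first gives \<open>1/k = n (1 + s)\<close>, which
  grows at most linearly. A Phragmen-Lindelof argument turns the two bounds into a bound for \<open>1/k\<close>
  on the whole half-plane (lemma \<open>common_divisor_bounded_below\<close>). So no inner factor
  \<open>exp (-ts)\<close> with \<open>t > 0\<close>, which \<open>b\<close> alone would permit, can occur in \<open>k\<close>.

  It remains to invert an element \<open>k = f + g\<close>, \<open>f\<close> in \<open>A0\<close> and \<open>g\<close> in \<open>AP_plus\<close>, with
  \<open>d \<le> |k|\<close> (lemma \<open>carrier_inverse\<close>). Almost periodic functions recur under arbitrarily long
  vertical translations, under which \<open>f\<close> dies out; hence \<open>d \<le> |g|\<close>. Then \<open>1/g\<close> is in \<open>AP_plus\<close>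
  by a continuity argument (lemma \<open>AP_inverse\<close>): the translates \<open>s \<mapsto> g (s + x)\<close>, \<open>0 \<le> x\<close>, depend
  continuously on \<open>x\<close> in the supremum norm, are close to a nonzero constant for large \<open>x\<close>, and
  any inverse among them has norm at most \<open>1/d\<close>; so Neumann series of a fixed radius carry
  invertibility from large \<open>x\<close> down to \<open>x = 0\<close>. Finally \<open>1/k = 1/g - f/(k g)\<close>, where the last
  term lies in \<open>A0\<close>.
\<close>

section \<open>Translations of causal almost periodic functions\<close>

text \<open>The restriction to the half-plane is dropped from the approximating sum, so that it can be
  translated freely.\<close>

lemma AP_exp_span_approx:
  assumes "g \<in> AP_plus" "e > 0"
  obtains T c where "finite T" "T \<subseteq> {0..}" "\<And>s. s \<in> closed_rhp \<Longrightarrow>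
    cmod (g s - (\<Sum>t\<in>T. c t * exp (- (s * complex_of_real t)))) \<le> e"
proof -
  obtain q where q: "q \<in> exp_span" "\<forall>s\<in>closed_rhp. cmod (g s - q s) \<le> e"
    using assms by (auto simp: AP_plus_def)
  then obtain T c where T: "finite T" "T \<subseteq> {0..}"
    and qe: "q = (\<lambda>s\<in>closed_rhp. \<Sum>t\<in>T. c t * exp (- (s * complex_of_real t)))"
    by (auto simp: exp_span_def)
  show ?thesis
    by (rule that[OF T, of c]) (use q(2) in \<open>auto simp: qe\<close>)
qed

lemma closed_rhp_add: "s \<in> closed_rhp \<Longrightarrow> w \<in> closed_rhp \<Longrightarrow> s + w \<in> closed_rhp"
  by (simp add: closed_rhp_def)

lemma AP_closed:
  assumes "f \<in> extensional closed_rhp"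
    and "\<And>e. e > 0 \<Longrightarrow> \<exists>g\<in>AP_plus. \<forall>s\<in>closed_rhp. cmod (f s - g s) \<le> e"
  shows "f \<in> AP_plus"
  unfolding AP_plus_def
proof (intro CollectI conjI allI impI assms(1))
  fix e :: real assume "e > 0"
  then have e2: "e / 2 > 0" by simp
  obtain g where g: "g \<in> AP_plus" "\<forall>s\<in>closed_rhp. cmod (f s - g s) \<le> e / 2"
    using assms(2)[OF e2] by blast
  obtain p where p: "p \<in> exp_span" "\<forall>s\<in>closed_rhp. cmod (g s - p s) \<le> e / 2"
    using g(1) e2 unfolding AP_plus_def by blast
  have "cmod (f s - p s) \<le> e" if "s \<in> closed_rhp" for s
    using norm_triangle_mono[of "f s - g s" "e / 2" "g s - p s" "e / 2"] g p that by simp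
  then show "\<exists>p\<in>exp_span. \<forall>s\<in>closed_rhp. cmod (f s - p s) \<le> e"
    using p(1) by blast
qed

text \<open>Translation by \<open>w\<close> multiplies the coefficient of \<open>exp (-st)\<close> by \<open>exp (-wt)\<close>.\<close>

lemma AP_translate:
  assumes g: "g \<in> AP_plus" and w: "w \<in> closed_rhp"
  shows "(\<lambda>s\<in>closed_rhp. g (s + w)) \<in> AP_plus"
proof (rule AP_closed)
  fix e :: real assume "e > 0"
  obtain T c where T: "finite T" "T \<subseteq> {0..}" and approx: "\<And>s. s \<in> closed_rhp \<Longrightarrow>
      cmod (g s - (\<Sum>t\<in>T. c t * exp (- (s * complex_of_real t)))) \<le> e"
    by (rule AP_exp_span_approx[OF g \<open>e > 0\<close>]) (rule that)
  define p where p: "p = (\<lambda>s. \<Sum>t\<in>T. c t * exp (- (s * complex_of_real t)))"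
  have le: "cmod (g s - p s) \<le> e" if "s \<in> closed_rhp" for s
    using approx[OF that] by (simp add: p)
  define q where "q = (\<lambda>s\<in>closed_rhp. \<Sum>t\<in>T. (c t * exp (- (w * complex_of_real t))) *
    exp (- (s * complex_of_real t)))"
  have "q \<in> exp_span"
    unfolding q_def using T by (intro exp_span_sum exp_span_monomial) auto
  moreover have "p (s + w) = q s" if "s \<in> closed_rhp" for s
    using that by (auto simp: p q_def ring_distribs exp_add exp_diff exp_minus field_simps
        intro!: sum.cong)
  ultimately show "\<exists>q\<in>AP_plus. \<forall>s\<in>closed_rhp.
      cmod ((\<lambda>s\<in>closed_rhp. g (s + w)) s - q s) \<le> e"
    using exp_span_subset_AP le[OF closed_rhp_add[OF _ w]] by (intro bexI[of _ q]) auto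
qed auto

text \<open>The derivative of \<open>exp (-zt)\<close> has modulus at most \<open>t\<close> on the half-plane.\<close>

lemma exp_neg_mult_lipschitz:
  assumes "t \<ge> 0" "s \<in> closed_rhp" "s' \<in> closed_rhp"
  shows "cmod (exp (- (s * complex_of_real t)) - exp (- (s' * complex_of_real t)))
    \<le> t * cmod (s - s')"
proof (rule field_differentiable_bound[where S = closed_rhp])
  show "convex closed_rhp"
    using convex_halfspace_ge[of 0 "1 :: complex"] by (simp add: closed_rhp_def inner_complex_def)
  fix z assume z: "z \<in> closed_rhp"
  show "((\<lambda>z. exp (- (z * complex_of_real t))) has_field_derivative
      - complex_of_real t * exp (- (z * complex_of_real t))) (at z within closed_rhp)"
    by (auto intro!: derivative_eq_intros)
  have "0 \<le> Re z * t"
    using z assms(1) by (auto simp: closed_rhp_def)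
  then show "cmod (- complex_of_real t * exp (- (z * complex_of_real t))) \<le> t"
    using assms(1) by (simp add: norm_mult mult_left_le)
qed (use assms in auto)

text \<open>Exponential sums are Lipschitz on the half-plane, and uniform limits preserve uniform
  continuity.\<close>

lemma AP_uniformly_continuous:
  assumes g: "g \<in> AP_plus"
  shows "uniformly_continuous_on closed_rhp g"
  unfolding uniformly_continuous_on_def
proof (intro allI impI)
  fix e :: real assume e: "e > 0"
  then have e3: "e / 4 > 0" by simp
  obtain T c where T: "finite T" "T \<subseteq> {0..}" and approx: "\<And>s. s \<in> closed_rhp \<Longrightarrow>
      cmod (g s - (\<Sum>t\<in>T. c t * exp (- (s * complex_of_real t)))) \<le> e / 4"
    by (rule AP_exp_span_approx[OF g e3]) (rule that)
  define p where p: "p = (\<lambda>s. \<Sum>t\<in>T. c t * exp (- (s * complex_of_real t)))"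
  have le: "cmod (g s - p s) \<le> e / 4" if "s \<in> closed_rhp" for s
    using approx[OF that] by (simp add: p)
  define L where "L = (\<Sum>t\<in>T. cmod (c t) * t) + 1"
  have "(\<Sum>t\<in>T. cmod (c t) * t) \<ge> 0"
    using T by (intro sum_nonneg) auto
  then have L: "L > 0" by (simp add: L_def)
  have lip: "cmod (p s - p s') \<le> L * cmod (s - s')"
    if "s \<in> closed_rhp" "s' \<in> closed_rhp" for s s'
  proof -
    have "cmod (p s - p s') \<le> (\<Sum>t\<in>T. cmod (c t) * (t * cmod (s - s')))"
      unfolding p sum_subtractf[symmetric] right_diff_distrib[symmetric]
      using T that by (intro sum_norm_le) (auto simp: norm_mult intro!: mult_left_mono exp_neg_mult_lipschitz)
    also have "\<dots> \<le> L * cmod (s - s')"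
      by (simp add: L_def sum_distrib_right sum_distrib_left algebra_simps)
    finally show ?thesis .
  qed
  show "\<exists>d>0. \<forall>x\<in>closed_rhp. \<forall>x'\<in>closed_rhp. dist x' x < d \<longrightarrow> dist (g x') (g x) < e"
  proof (intro exI[of _ "e / (4 * L)"] conjI ballI impI)
    show "e / (4 * L) > 0" using e L by simp
    fix s s' assume s: "s \<in> closed_rhp" "s' \<in> closed_rhp" and d: "dist s' s < e / (4 * L)"
    have "L * cmod (s' - s) \<le> L * (e / (4 * L))"
      using d L by (intro mult_left_mono) (auto simp: dist_norm)
    then have "cmod (p s' - p s) \<le> e / 4"
      using lip[OF s(2,1)] L by simp
    moreover have "cmod (g s' - g s) \<le> cmod (g s' - p s') + cmod (p s' - p s) + cmod (g s - p s)"
      by norm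
    ultimately show "dist (g s') (g s) < e"
      using le[OF s(1)] le[OF s(2)] e by (simp add: dist_norm)
  qed
qed

text \<open>The constant is the coefficient of the frequency \<open>0\<close>; every other term of an approximating
  exponential sum decays exponentially in the real part of \<open>s\<close>.\<close>

lemma AP_nearly_constant_far_right:
  assumes g: "g \<in> AP_plus" and e: "e > 0"
  obtains c M where "M \<ge> 0" "\<And>s. Re s \<ge> M \<Longrightarrow> cmod (g s - c) \<le> e"
proof -
  have e2: "e / 2 > 0" using e by simp
  obtain T c where T: "finite T" "T \<subseteq> {0..}" and approx: "\<And>s. s \<in> closed_rhp \<Longrightarrow>
      cmod (g s - (\<Sum>t\<in>T. c t * exp (- (s * complex_of_real t)))) \<le> e / 2"
    by (rule AP_exp_span_approx[OF g e2]) (rule that)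
  define p where p: "p = (\<lambda>s. \<Sum>t\<in>T. c t * exp (- (s * complex_of_real t)))"
  have le: "cmod (g s - p s) \<le> e / 2" if "s \<in> closed_rhp" for s
    using approx[OF that] by (simp add: p)
  define B where "B x = (\<Sum>t\<in>T - {0}. cmod (c t) * exp (- (x * t)))" for x
  have "((\<lambda>x. cmod (c t) * exp (- (x * t))) \<longlongrightarrow> 0) at_top" if "t \<in> T - {0}" for t
  proof (intro tendsto_mult_right_zero filterlim_compose[OF exp_at_bot])
    have "t > 0" using that T by force
    then show "LIM x at_top. - (x * t) :> at_bot"
      by (simp add: filterlim_uminus_at_bot filterlim_at_top_mult_tendsto_pos[OF tendsto_const] mult.commute filterlim_ident)
  qed
  then have "(B \<longlongrightarrow> (\<Sum>t\<in>T - {0}. 0)) at_top"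
    unfolding B_def by (intro tendsto_sum)
  then have "\<forall>\<^sub>F x in at_top. B x < e / 2"
    using e2 by (intro order_tendstoD(2)) auto
  then obtain M where M: "\<And>x. x \<ge> M \<Longrightarrow> B x < e / 2"
    by (auto simp: eventually_at_top_linorder)
  define c0 where "c0 = (if 0 \<in> T then c 0 else 0)"
  have near: "cmod (g s - c0) \<le> e" if s: "Re s \<ge> max M 0" for s
  proof -
    have "p s = c0 + (\<Sum>t\<in>T - {0}. c t * exp (- (s * complex_of_real t)))"
      using T by (cases "0 \<in> T") (auto simp: p c0_def sum.remove)
    then have "cmod (p s - c0) \<le> B (Re s)"
      unfolding B_def by (auto intro!: sum_norm_le simp: norm_mult)
    then show ?thesis
      using norm_triangle_mono[of "g s - p s" "e / 2" "p s - c0" "e / 2"] le[of s] M[of "Re s"] s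
      by (simp add: closed_rhp_def)
  qed
  show ?thesis
    by (rule that[of "max M 0" c0]) (use near in auto)
qed

text \<open>A translation by \<open>\<i> \<tau>\<close> almost fixes an exponential sum as soon as \<open>\<tau> t / (2 \<pi>)\<close> is near an
  integer for each of its finitely many frequencies \<open>t\<close>. Dirichlet's simultaneous approximation
  theorem supplies such \<open>\<tau>\<close>; seeking it among the positive multiples of \<open>b\<close> makes it as large as
  desired.\<close>

lemma AP_recurrent:
  assumes g: "g \<in> AP_plus" and e: "e > 0" and b: "b > 0"
  obtains \<tau> where "\<tau> \<ge> b" "\<And>s. s \<in> closed_rhp \<Longrightarrow> cmod (g (s + \<i> * complex_of_real \<tau>) - g s) \<le> e"
proof -
  have e3: "e / 3 > 0" using e by simp
  obtain T c where T: "finite T" "T \<subseteq> {0..}" and approx: "\<And>s. s \<in> closed_rhp \<Longrightarrow>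
      cmod (g s - (\<Sum>t\<in>T. c t * exp (- (s * complex_of_real t)))) \<le> e / 3"
    by (rule AP_exp_span_approx[OF g e3]) (rule that)
  define p where p: "p = (\<lambda>s. \<Sum>t\<in>T. c t * exp (- (s * complex_of_real t)))"
  have le: "cmod (g s - p s) \<le> e / 3" if "s \<in> closed_rhp" for s
    using approx[OF that] by (simp add: p)
  define C where "C = (\<Sum>t\<in>T. cmod (c t))"
  \<comment> \<open>an error of \<open>2 \<pi> / N\<close> in each exponential changes the sum by at most \<open>2 \<pi> C / N < e / 3\<close>\<close>
  obtain N :: nat where N: "6 * pi * C / e < real N" "N > 0"
    using reals_Archimedean2[of "max (6 * pi * C / e) 0"] by auto
  obtain h where h: "bij_betw h {0..<card T} T"
    using ex_bij_betw_nat_finite[OF T(1)] by blast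
  obtain q k where q: "0 < q"
    and k: "\<And>i. i < card T \<Longrightarrow> \<bar>of_int q * (b * h i / (2 * pi)) - of_int (k i)\<bar> < 1 / N"
    using Dirichlet_approx_simult[OF N(2), of "card T" "\<lambda>i. b * h i / (2 * pi)"] by metis
  define \<tau> where "\<tau> = of_int q * b"
  have "real_of_int q \<ge> 1" using q by simp
  then have \<tau>: "\<tau> \<ge> b" using b by (simp add: \<tau>_def)
  have near1: "cmod (exp (- (\<i> * complex_of_real \<tau> * complex_of_real t)) - 1) \<le> 2 * pi / N"
    if t: "t \<in> T" for t
  proof -
    obtain i where i: "i < card T" "t = h i"
      using t bij_betw_imp_surj_on[OF h] by force
    \<comment> \<open>the phase \<open>- \<tau> t\<close>, reduced modulo \<open>2 \<pi>\<close>\<close>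
    define y where "y = 2 * pi * (of_int (k i) - of_int q * (b * t / (2 * pi)))"
    have "- (\<i> * complex_of_real \<tau> * complex_of_real t) =
        \<i> * complex_of_real y - (2 * of_int (k i) * pi) * \<i>"
      by (simp add: y_def \<tau>_def field_simps complex_eq_iff)
    then have "exp (- (\<i> * complex_of_real \<tau> * complex_of_real t)) = exp (\<i> * complex_of_real y)"
      by (simp only: exp_diff exp_integer_2pi[OF Ints_of_int] div_by_1)
    then have "cmod (exp (- (\<i> * complex_of_real \<tau> * complex_of_real t)) - 1) = 2 * \<bar>sin (y / 2)\<bar>"
      by (simp only: dist_exp_i_1)
    also have "\<dots> \<le> \<bar>y\<bar>"
      using abs_sin_x_le_abs_x[of "y / 2"] by simp
    also have "\<dots> = 2 * pi * \<bar>of_int q * (b * h i / (2 * pi)) - of_int (k i)\<bar>"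
      by (simp add: y_def i abs_mult abs_minus_commute)
    also have "\<dots> \<le> 2 * pi * (1 / N)"
      using k[OF i(1)] by (intro mult_left_mono) auto
    finally show ?thesis by simp
  qed
  have per: "cmod (p (s + \<i> * complex_of_real \<tau>) - p s) \<le> e / 3" if s: "s \<in> closed_rhp" for s
  proof -
    have "p (s + \<i> * complex_of_real \<tau>) - p s = (\<Sum>t\<in>T. c t * (exp (- (s * complex_of_real t)) *
        (exp (- (\<i> * complex_of_real \<tau> * complex_of_real t)) - 1)))"
      unfolding p sum_subtractf[symmetric]
      by (intro sum.cong refl) (simp add: ring_distribs exp_add exp_diff exp_minus field_simps)
    also have "cmod \<dots> \<le> (\<Sum>t\<in>T. cmod (c t) * (1 * (2 * pi / N)))"
    proof (rule sum_norm_le)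
      fix t assume t: "t \<in> T"
      have "0 \<le> Re s * t"
        using s t T by (auto simp: closed_rhp_def intro!: mult_nonneg_nonneg)
      then have "cmod (exp (- (s * complex_of_real t))) \<le> 1" by simp
      then show "cmod (c t * (exp (- (s * complex_of_real t)) *
          (exp (- (\<i> * complex_of_real \<tau> * complex_of_real t)) - 1)))
          \<le> cmod (c t) * (1 * (2 * pi / N))"
        unfolding norm_mult using near1[OF t] by (intro mult_left_mono mult_mono) auto
    qed
    also have "\<dots> = C * (2 * pi / N)"
      by (simp only: C_def sum_distrib_right mult_1)
    also have "\<dots> \<le> e / 3"
      using N e by (simp add: field_simps)
    finally show ?thesis .
  qed
  show ?thesis
  proof (rule that[OF \<tau>])
    fix s assume s: "s \<in> closed_rhp"
    define s' where "s' = s + \<i> * complex_of_real \<tau>"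
    have s': "s' \<in> closed_rhp" using s by (simp add: s'_def closed_rhp_def)
    have "cmod (g s' - g s) \<le> cmod (g s' - p s') + cmod (p s' - p s) + cmod (g s - p s)"
      by norm
    then show "cmod (g (s + \<i> * complex_of_real \<tau>) - g s) \<le> e"
      using le[OF s] le[OF s'] per[OF s] unfolding s'_def by linarith
  qed
qed

section \<open>Inverting elements that are bounded away from zero\<close>

lemma AP_power: "r \<in> AP_plus \<Longrightarrow> (\<lambda>s\<in>closed_rhp. r s ^ n) \<in> AP_plus"
proof (induction n)
  case 0
  show ?case using AP_const[of 1] by (simp only: power_0)
next
  case (Suc n)
  have "(\<lambda>s\<in>closed_rhp. r s ^ Suc n) =
      (\<lambda>s\<in>closed_rhp. r s * (\<lambda>s\<in>closed_rhp. r s ^ n) s)"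
    by (rule restrict_ext) simp
  also have "\<dots> \<in> AP_plus"
    by (intro AP_mult Suc)
  finally show ?case .
qed

lemma AP_sum:
  assumes "finite I" "\<And>i. i \<in> I \<Longrightarrow> (\<lambda>s\<in>closed_rhp. f i s) \<in> AP_plus"
  shows "(\<lambda>s\<in>closed_rhp. \<Sum>i\<in>I. f i s) \<in> AP_plus"
  using assms
proof (induction I rule: finite_induct)
  case empty
  show ?case using AP_const[of 0] by (simp only: sum.empty)
next
  case (insert i I)
  have "(\<lambda>s\<in>closed_rhp. \<Sum>j\<in>insert i I. f j s) = (\<lambda>s\<in>closed_rhp.
      (\<lambda>s\<in>closed_rhp. f i s) s + (\<lambda>s\<in>closed_rhp. \<Sum>j\<in>I. f j s) s)"
    using insert.hyps by (intro restrict_ext) simp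
  also have "\<dots> \<in> AP_plus"
    by (intro AP_add insert.IH insert.prems) auto
  finally show ?case .
qed

text \<open>With \<open>r = 1 - v/u\<close> one has \<open>|r| \<le> 1/2\<close> and \<open>1/v = (1/u) / (1 - r)\<close>, so the geometric series
  converges uniformly to the inverse of \<open>v\<close>. The radius \<open>m/2\<close> depends only on the lower bound
  for \<open>u\<close>, which lets this step be iterated.\<close>

lemma AP_inverse_near:
  assumes u: "u \<in> AP_plus" and v: "v \<in> AP_plus" and m: "m > 0"
    and inv: "(\<lambda>s\<in>closed_rhp. inverse (u s)) \<in> AP_plus"
    and lower: "\<And>s. s \<in> closed_rhp \<Longrightarrow> cmod (u s) \<ge> m"
    and near: "\<And>s. s \<in> closed_rhp \<Longrightarrow> cmod (v s - u s) \<le> m / 2"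
  shows "(\<lambda>s\<in>closed_rhp. inverse (v s)) \<in> AP_plus"
proof -
  define w where "w = (\<lambda>s\<in>closed_rhp. inverse (u s))"
  define r where "r = (\<lambda>s\<in>closed_rhp. 1 - w s * v s)"
  have w: "w \<in> AP_plus" using inv by (simp add: w_def)
  have "r = (\<lambda>s\<in>closed_rhp. (\<lambda>s\<in>closed_rhp. 1) s +
      (\<lambda>s\<in>closed_rhp. (\<lambda>s\<in>closed_rhp. - 1) s * (\<lambda>s\<in>closed_rhp. w s * v s) s) s)"
    unfolding r_def by (rule restrict_ext) simp
  also have "\<dots> \<in> AP_plus"
    by (intro AP_add AP_mult AP_const w v)
  finally have r: "r \<in> AP_plus" .
  show ?thesis
  proof (rule AP_closed)
    fix e :: real assume e: "e > 0"
    have "(\<lambda>n. (2 / m) * (1 / 2) ^ n) \<longlonglongrightarrow> 0"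
      by (intro tendsto_mult_right_zero LIMSEQ_power_zero) auto
    then have "\<forall>\<^sub>F n in sequentially. (2 / m) * (1 / 2) ^ n < e"
      using e by (rule order_tendstoD)
    then obtain n where n: "(2 / m) * (1 / 2) ^ n < e"
      by (auto simp: eventually_sequentially)
    define q where "q = (\<lambda>s\<in>closed_rhp. w s * (\<lambda>s\<in>closed_rhp. \<Sum>i<n. r s ^ i) s)"
    have "q \<in> AP_plus"
      unfolding q_def by (intro AP_mult w AP_sum AP_power r) auto
    moreover have "cmod (inverse (v s) - q s) \<le> e" if s: "s \<in> closed_rhp" for s
    proof -
      have us: "cmod (u s) \<ge> m" "u s \<noteq> 0"
        using lower[OF s] m by auto
      have "cmod (u s) \<le> cmod (v s) + cmod (v s - u s)" by norm
      then have vs: "cmod (v s) \<ge> m / 2" using us near[OF s] by linarith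
      then have vs0: "v s \<noteq> 0" using m by auto
      have rs: "r s = (u s - v s) / u s" "1 - r s = v s / u s"
        using s us by (auto simp: r_def w_def field_simps)
      have "cmod (u s - v s) \<le> (1 / 2) * m"
        using near[OF s] by (simp add: norm_minus_commute)
      also have "\<dots> \<le> (1 / 2) * cmod (u s)" using us by simp
      finally have r2: "cmod (r s) \<le> 1 / 2"
        unfolding rs norm_divide using us by (simp add: divide_le_eq)
      have "r s \<noteq> 1" using r2 by auto
      then have "(\<Sum>i<n. r s ^ i) = (1 - r s ^ n) / (1 - r s)"
        using one_diff_power_eq[of "r s" n] by (simp add: field_simps)
      then have "inverse (v s) - q s = inverse (v s) * r s ^ n"
        using s us vs0 by (simp add: q_def w_def rs(2)) (simp add: field_simps)
      also have "cmod \<dots> \<le> (2 / m) * (1 / 2) ^ n"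
      proof -
        have "cmod (inverse (v s)) \<le> inverse (m / 2)"
          unfolding norm_inverse using vs m by (intro le_imp_inverse_le) auto
        moreover have "cmod (r s) ^ n \<le> (1 / 2) ^ n"
          using r2 by (intro power_mono) auto
        ultimately show ?thesis
          unfolding norm_mult norm_power using m by (intro mult_mono) auto
      qed
      finally show ?thesis using n by linarith
    qed
    ultimately show "\<exists>g\<in>AP_plus. \<forall>s\<in>closed_rhp.
        cmod ((\<lambda>s\<in>closed_rhp. inverse (v s)) s - g s) \<le> e"
      by (intro bexI[of _ q]) auto
  qed auto
qed

text \<open>Invertibility is transported along the translates \<open>G x\<close> from \<open>x = M\<close>, where \<open>G x\<close> is close to
  a constant, to \<open>x = 0\<close>. All translates inherit the lower bound \<open>d\<close>, so steps of one fixed length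
  \<open>\<eta>\<close> suffice.\<close>

lemma AP_inverse:
  assumes g: "g \<in> AP_plus" and d: "d > 0"
    and lower: "\<And>s. s \<in> closed_rhp \<Longrightarrow> cmod (g s) \<ge> d"
  shows "(\<lambda>s\<in>closed_rhp. inverse (g s)) \<in> AP_plus"
proof -
  define G where "G x = (\<lambda>s\<in>closed_rhp. g (s + complex_of_real x))" for x
  have sx: "s + complex_of_real x \<in> closed_rhp" if "s \<in> closed_rhp" "x \<ge> 0" for s x
    using that by (simp add: closed_rhp_def)
  have G: "G x \<in> AP_plus" if "x \<ge> 0" for x
    unfolding G_def using that by (intro AP_translate g) (simp add: closed_rhp_def)
  have G_lower: "cmod (G x s) \<ge> d" if "s \<in> closed_rhp" "x \<ge> 0" for x s
    using that lower[OF sx] by (simp add: G_def)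
  have "d / 4 > 0" using d by simp
  then obtain c M where M: "M \<ge> 0" and c: "\<And>s. Re s \<ge> M \<Longrightarrow> cmod (g s - c) \<le> d / 4"
    by (rule AP_nearly_constant_far_right[OF g]) (rule that)
  \<comment> \<open>\<open>|c| \<ge> 3 d / 4\<close>, and a deviation of \<open>d / 4\<close> is within half of the lower bound \<open>d / 2\<close>\<close>
  have start: "(\<lambda>s\<in>closed_rhp. inverse (G M s)) \<in> AP_plus"
  proof (rule AP_inverse_near[of "\<lambda>s\<in>closed_rhp. c" "G M" "d / 2"])
    have "cmod (g (complex_of_real M)) \<ge> d"
      using lower[of "complex_of_real M"] M by (simp add: closed_rhp_def)
    moreover have "cmod (g (complex_of_real M)) \<le> cmod c + cmod (g (complex_of_real M) - c)"
      by norm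
    ultimately have "cmod c \<ge> d / 2"
      using c[of "complex_of_real M"] d by simp
    then show "cmod ((\<lambda>s\<in>closed_rhp. c) s) \<ge> d / 2" if "s \<in> closed_rhp" for s
      using that by simp
    show "cmod (G M s - (\<lambda>s\<in>closed_rhp. c) s) \<le> d / 2 / 2" if "s \<in> closed_rhp" for s
      using that c[of "s + complex_of_real M"] by (simp add: G_def closed_rhp_def)
    show "(\<lambda>s\<in>closed_rhp. inverse ((\<lambda>s\<in>closed_rhp. c) s)) \<in> AP_plus"
      using AP_const[of "inverse c"] by (simp cong: restrict_cong)
  qed (use d AP_const G[OF M] in auto)
  have "d / 2 > 0" using d by simp
  then obtain h where h: "h > 0" and unif: "\<And>s s'. s \<in> closed_rhp \<Longrightarrow> s' \<in> closed_rhp \<Longrightarrow>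
      dist s' s < h \<Longrightarrow> dist (g s') (g s) < d / 2"
    using AP_uniformly_continuous[OF g] unfolding uniformly_continuous_on_def by metis
  obtain N :: nat where N: "N > 0" "M / h < real N"
    using reals_Archimedean2[of "max (M / h) 0"] by auto
  define \<eta> where "\<eta> = M / N"
  have \<eta>: "0 \<le> \<eta>" "\<eta> < h" "N * \<eta> = M"
    using N M h by (auto simp: \<eta>_def field_simps)
  have step: "(\<lambda>s\<in>closed_rhp. inverse (G (M - n * \<eta>) s)) \<in> AP_plus" if "n \<le> N" for n
    using that
  proof (induction n)
    case 0
    show ?case using start by (simp only: of_nat_0 mult_zero_left diff_zero)
  next
    case (Suc n)
    have "real (Suc n) * \<eta> \<le> N * \<eta>"
      using Suc.prems \<eta> by (intro mult_right_mono) auto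
    then have nn: "M - real (Suc n) * \<eta> \<ge> 0" "M - real n * \<eta> \<ge> 0"
      using \<eta> by (auto simp: algebra_simps)
    show ?case
    proof (rule AP_inverse_near[OF G[OF nn(2)] G[OF nn(1)] d])
      fix s assume s: "s \<in> closed_rhp"
      show "cmod (G (M - n * \<eta>) s) \<ge> d"
        using G_lower[OF s nn(2)] .
      have "dist (s + complex_of_real (M - real (Suc n) * \<eta>)) (s + complex_of_real (M - n * \<eta>)) = \<eta>"
        unfolding dist_add_cancel dist_of_real using \<eta> by (simp add: dist_real_def algebra_simps)
      then show "cmod (G (M - real (Suc n) * \<eta>) s - G (M - n * \<eta>) s) \<le> d / 2"
        using unif[OF sx[OF s nn(2)] sx[OF s nn(1)]] \<eta> s by (simp add: G_def dist_norm)
    next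
      show "(\<lambda>s\<in>closed_rhp. inverse (G (M - n * \<eta>) s)) \<in> AP_plus"
        using Suc.IH Suc.prems by (simp only: Suc_leD)
    qed
  qed
  have "(\<lambda>s\<in>closed_rhp. inverse (G 0 s)) \<in> AP_plus"
    using step[of N] \<eta> by simp
  then show ?thesis
    by (simp add: G_def cong: restrict_cong)
qed

lemma A0_bounded:
  assumes "f \<in> A0"
  shows "\<exists>B. \<forall>s\<in>closed_rhp. cmod (f s) \<le> B"
proof -
  have "\<forall>\<^sub>F s in inf at_infinity (principal closed_rhp). dist (f s) 0 < 1"
    using A0_D(4)[OF assms] by (rule tendstoD) simp
  then obtain R where R: "\<And>s. s \<in> closed_rhp \<Longrightarrow> cmod s \<ge> R \<Longrightarrow> cmod (f s) < 1"
    by (auto simp: eventually_inf_principal eventually_at_infinity)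
  have "closed closed_rhp"
    using closed_halfspace_Re_ge[of 0] by (simp add: closed_rhp_def)
  then have "compact (closed_rhp \<inter> cball 0 R)"
    by (intro closed_Int_compact) auto
  then have "compact (f ` (closed_rhp \<inter> cball 0 R))"
    using A0_D(3)[OF assms] by (intro compact_continuous_image) (auto intro: continuous_on_subset)
  then obtain B where B: "\<forall>z\<in>f ` (closed_rhp \<inter> cball 0 R). cmod z \<le> B"
    using compact_imp_bounded bounded_iff by metis
  have "cmod (f s) \<le> max B 1" if "s \<in> closed_rhp" for s
    using B R[OF that] that by (cases "cmod s \<le> R") (auto simp: le_max_iff_disj)
  then show ?thesis by blast
qed

lemma carrier_bounded:
  assumes "h \<in> carrier A0_AP_plus"
  obtains B where "B > 0" "\<And>s. s \<in> closed_rhp \<Longrightarrow> cmod (h s) \<le> B"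
proof -
  obtain f g where fg: "f \<in> A0" "g \<in> AP_plus" and h: "h = (\<lambda>s\<in>closed_rhp. f s + g s)"
    using assms by (auto simp: carrier_A0_AP_plus_iff)
  obtain B C where B: "\<forall>s\<in>closed_rhp. cmod (f s) \<le> B" and C: "\<forall>s\<in>closed_rhp. cmod (g s) \<le> C"
    using A0_bounded[OF fg(1)] AP_D(3)[OF fg(2)] by blast
  have "cmod (h s) \<le> max (B + C) 1" if "s \<in> closed_rhp" for s
    using norm_triangle_mono[of "f s" B "g s" C] B C that by (auto simp: h)
  then show ?thesis by (intro that[of "max (B + C) 1"]) auto
qed

text \<open>Along a sequence of translations under which \<open>g\<close> recurs at \<open>s\<close>, the \<open>A0\<close> part tends to \<open>0\<close>,
  so \<open>f + g\<close> takes values arbitrarily close to \<open>g s\<close>.\<close>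

lemma AP_part_lower_bound:
  assumes f: "f \<in> A0" and g: "g \<in> AP_plus"
    and lower: "\<And>s. s \<in> closed_rhp \<Longrightarrow> cmod (f s + g s) \<ge> d"
    and s: "s \<in> closed_rhp"
  shows "cmod (g s) \<ge> d"
proof (rule field_le_epsilon)
  fix e :: real assume "e > 0"
  then have e2: "e / 2 > 0" by simp
  have "\<forall>\<^sub>F z in inf at_infinity (principal closed_rhp). dist (f z) 0 < e / 2"
    using A0_D(4)[OF f] e2 by (rule tendstoD)
  then obtain R where R: "\<And>z. z \<in> closed_rhp \<Longrightarrow> cmod z \<ge> R \<Longrightarrow> cmod (f z) < e / 2"
    by (auto simp: eventually_inf_principal eventually_at_infinity)
  have "\<bar>R\<bar> + cmod s + 1 > 0"
    using norm_ge_zero[of s] by linarith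
  then obtain \<tau> where \<tau>: "\<tau> \<ge> \<bar>R\<bar> + cmod s + 1"
    and per: "\<And>z. z \<in> closed_rhp \<Longrightarrow> cmod (g (z + \<i> * complex_of_real \<tau>) - g z) \<le> e / 2"
    by (rule AP_recurrent[OF g e2]) (rule that)
  define z where "z = s + \<i> * complex_of_real \<tau>"
  have z: "z \<in> closed_rhp" using s by (simp add: z_def closed_rhp_def)
  have "\<tau> \<ge> 0"
    using \<tau> norm_ge_zero[of s] by linarith
  then have "\<tau> = cmod (\<i> * complex_of_real \<tau>)"
    by (simp add: norm_mult)
  also have "\<dots> \<le> cmod z + cmod s"
    unfolding z_def by norm
  finally have "cmod z \<ge> R" using \<tau> by linarith
  then have "cmod (f z) < e / 2" using R z by blast
  moreover have "cmod (f z + g z) \<le> cmod (f z) + cmod (g z - g s) + cmod (g s)" by norm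
  ultimately show "d \<le> cmod (g s) + e"
    using lower[OF z] per[OF s] unfolding z_def by linarith
qed

text \<open>If \<open>k = f + g\<close>, then \<open>1/k = 1/g - f/(k g)\<close>, and \<open>A0\<close> absorbs the bounded factor \<open>1/(k g)\<close>.\<close>

lemma carrier_inverse:
  assumes k: "k \<in> carrier A0_AP_plus" and d: "d > 0"
    and lower: "\<And>s. s \<in> closed_rhp \<Longrightarrow> cmod (k s) \<ge> d"
  shows "(\<lambda>s\<in>closed_rhp. inverse (k s)) \<in> carrier A0_AP_plus"
proof -
  obtain f g where f: "f \<in> A0" and g: "g \<in> AP_plus" and k_eq: "k = (\<lambda>s\<in>closed_rhp. f s + g s)"
    using k by (auto simp: carrier_A0_AP_plus_iff)
  have g_lower: "cmod (g s) \<ge> d" if "s \<in> closed_rhp" for s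
    using AP_part_lower_bound[OF f g _ that] lower by (auto simp: k_eq)
  define u where "u = (\<lambda>s\<in>closed_rhp. - f s * inverse (k s) * inverse (g s))"
  have k0: "k s \<noteq> 0" "g s \<noteq> 0" if "s \<in> closed_rhp" for s
    using lower[OF that] g_lower[OF that] d by auto
  have "u \<in> A0"
    unfolding u_def
  proof (rule A0_restrictI)
    show "(\<lambda>s. - f s * inverse (k s) * inverse (g s)) holomorphic_on open_rhp"
      using k0 open_rhp_subset
      by (intro holomorphic_intros A0_D[OF f] AP_D[OF g] carrier_D[OF k]) auto
    show "continuous_on closed_rhp (\<lambda>s. - f s * inverse (k s) * inverse (g s))"
      using k0 by (intro continuous_intros A0_D[OF f] AP_D[OF g] carrier_D[OF k]) auto
    show "((\<lambda>s. - f s * inverse (k s) * inverse (g s)) \<longlongrightarrow> 0)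
        (inf at_infinity (principal closed_rhp))"
    proof (rule Lim_null_comparison)
      have "norm (- f s * inverse (k s) * inverse (g s)) \<le> cmod (f s) * inverse d * inverse d"
        if s: "s \<in> closed_rhp" for s
        unfolding norm_mult norm_inverse norm_minus_cancel
        using lower[OF s] g_lower[OF s] d by (intro mult_mono le_imp_inverse_le) auto
      then show "\<forall>\<^sub>F s in inf at_infinity (principal closed_rhp).
          norm (- f s * inverse (k s) * inverse (g s)) \<le> cmod (f s) * inverse d * inverse d"
        by (auto simp: eventually_inf_principal intro!: always_eventually)
      show "((\<lambda>s. cmod (f s) * inverse d * inverse d) \<longlongrightarrow> 0)
          (inf at_infinity (principal closed_rhp))"
        by (intro tendsto_mult_left_zero tendsto_norm_zero A0_D[OF f])
    qed
  qed
  moreover have "(\<lambda>s\<in>closed_rhp. inverse (g s)) \<in> AP_plus"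
    using AP_inverse[OF g d g_lower] .
  moreover have "(\<lambda>s\<in>closed_rhp. inverse (k s)) =
      (\<lambda>s\<in>closed_rhp. u s + (\<lambda>s\<in>closed_rhp. inverse (g s)) s)"
  proof (rule restrict_ext)
    fix s assume s: "s \<in> closed_rhp"
    have "- f s = g s - k s" using s by (simp add: k_eq)
    then have "u s = (g s - k s) * inverse (k s) * inverse (g s)"
      using s by (simp only: u_def restrict_apply if_True)
    then show "inverse (k s) = u s + (\<lambda>s\<in>closed_rhp. inverse (g s)) s"
      using k0[OF s] s by (simp add: field_simps)
  qed
  ultimately show ?thesis
    unfolding carrier_A0_AP_plus_iff by blast
qed

section \<open>A Phragmen-Lindelof principle\<close>

text \<open>Dividing by \<open>(1 + e s)\<^sup>2\<close> with \<open>e > 0\<close> makes the function decay at infinity and does not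
  increase it on the imaginary axis, so the maximum principle on large half-discs applies; then
  \<open>e\<close> tends to \<open>0\<close>.\<close>

lemma phragmen_lindelof_linear_growth:
  assumes hol: "F holomorphic_on open_rhp" and cont: "continuous_on closed_rhp F"
    and B: "B > 0" "\<And>s. Re s = 0 \<Longrightarrow> cmod (F s) \<le> B"
    and growth: "\<And>s. s \<in> closed_rhp \<Longrightarrow> cmod (F s) \<le> C * (1 + cmod s)"
    and w: "w \<in> closed_rhp"
  shows "cmod (F w) \<le> B"
proof -
  have damped: "cmod (F w) \<le> B * (1 + e * cmod w)\<^sup>2" if e: "e > 0" for e
  proof -
    define G where "G s = F s / (1 + complex_of_real e * s)\<^sup>2" for s
    have Re1: "Re (1 + complex_of_real e * s) \<ge> 1" if "s \<in> closed_rhp" for s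
      using that e by (simp add: closed_rhp_def)
    have ge1: "cmod (1 + complex_of_real e * s) \<ge> 1" if "s \<in> closed_rhp" for s
      using Re1[OF that] complex_Re_le_cmod order_trans by blast
    have ges: "cmod (1 + complex_of_real e * s) \<ge> e * cmod s" if s: "s \<in> closed_rhp" for s
    proof (rule power2_le_imp_le)
      show "(e * cmod s)\<^sup>2 \<le> (cmod (1 + complex_of_real e * s))\<^sup>2"
        using s e unfolding power_mult_distrib cmod_power2
        by (simp add: closed_rhp_def power2_eq_square algebra_simps)
    qed auto
    have nz: "1 + complex_of_real e * s \<noteq> 0" if "s \<in> closed_rhp" for s
      using ge1[OF that] by auto
    have "((\<lambda>x. C * (1 + x) / (e * x)\<^sup>2) \<longlongrightarrow> 0) at_top"
      using e by real_asymp
    then have "\<forall>\<^sub>F x in at_top. C * (1 + x) / (e * x)\<^sup>2 < B"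
      using B by (intro order_tendstoD)
    then obtain R0 where R0: "\<And>x. x \<ge> R0 \<Longrightarrow> C * (1 + x) / (e * x)\<^sup>2 < B"
      by (auto simp: eventually_at_top_linorder)
    define R where "R = max R0 (cmod w) + 1"
    have R: "R > 0" "R \<ge> R0" "cmod w \<le> R"
      by (auto simp: R_def intro: order.strict_trans1[OF norm_ge_zero[of w]])
    define S where "S = closed_rhp \<inter> cball 0 R"
    have closed: "closed S"
      unfolding S_def closed_rhp_def by (intro closed_Int closed_cball closed_halfspace_Re_ge)
    have interior: "interior S = open_rhp \<inter> ball 0 R"
      using interior_halfspace_ge[of "1 :: complex" 0]
      by (simp add: S_def interior_Int closed_rhp_def open_rhp_def inner_complex_def)
    have G_hol: "G holomorphic_on interior S"
      unfolding G_def interior using nz open_rhp_subset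
      by (intro holomorphic_intros holomorphic_on_subset[OF hol]) auto
    have G_cont: "continuous_on (closure S) G"
      unfolding G_def closure_closed[OF closed] using nz
      by (intro continuous_intros continuous_on_subset[OF cont]) (auto simp: S_def)
    have "cmod (G w) \<le> B"
    proof (rule maximum_modulus_frontier[OF G_hol G_cont])
      show "bounded S" unfolding S_def by (intro bounded_Int) auto
      show "w \<in> S" using w R by (simp add: S_def)
      fix z assume "z \<in> frontier S"
      then have z: "z \<in> closed_rhp" "Re z = 0 \<or> cmod z = R"
        unfolding frontier_def interior closure_closed[OF closed]
        by (auto simp: S_def closed_rhp_def open_rhp_def)
      from z(2) show "cmod (G z) \<le> B"
      proof
        assume "Re z = 0"
        then have "cmod (F z) \<le> B * 1" using B by simp
        also have "\<dots> \<le> B * (cmod (1 + complex_of_real e * z))\<^sup>2"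
          using B ge1[OF z(1)] by (intro mult_left_mono one_le_power) auto
        finally show ?thesis
          using nz[OF z(1)] by (simp add: G_def norm_divide norm_power divide_le_eq)
      next
        assume zR: "cmod z = R"
        have "cmod (G z) = cmod (F z) / (cmod (1 + complex_of_real e * z))\<^sup>2"
          by (simp add: G_def norm_divide norm_power)
        also have "\<dots> \<le> (C * (1 + R)) / (e * R)\<^sup>2"
          using growth[OF z(1)] ges[OF z(1)] zR e R
          by (intro frac_le power_mono) (auto intro: order_trans[OF norm_ge_zero])
        also have "\<dots> \<le> B" using R0[OF R(2)] by simp
        finally show ?thesis .
      qed
    qed
    then have "cmod (F w) \<le> B * (cmod (1 + complex_of_real e * w))\<^sup>2"
      using nz[OF w] by (simp add: G_def norm_divide norm_power divide_le_eq)
    also have "\<dots> \<le> B * (1 + e * cmod w)\<^sup>2"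
      using B e norm_triangle_ineq[of 1 "complex_of_real e * w"]
      by (intro mult_left_mono power_mono) (auto simp: norm_mult)
    finally show ?thesis .
  qed
  have "((\<lambda>e. B * (1 + e * cmod w)\<^sup>2) \<longlongrightarrow> B * (1 + 0 * cmod w)\<^sup>2) (at_right 0)"
    by (intro tendsto_intros)
  then show ?thesis
    using damped by (intro tendsto_lowerbound[of _ B "at_right 0"])
      (auto simp: eventually_at_filter)
qed

section \<open>The coprime pair\<close>

lemma A0_AP_plus_simps:
  "x \<oplus>\<^bsub>A0_AP_plus\<^esub> y = (\<lambda>s\<in>closed_rhp. x s + y s)"
  "x \<otimes>\<^bsub>A0_AP_plus\<^esub> y = (\<lambda>s\<in>closed_rhp. x s * y s)"
  "\<one>\<^bsub>A0_AP_plus\<^esub> = (\<lambda>s\<in>closed_rhp. 1)"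
  by (simp_all add: A0_AP_plus_def)

definition first_order_lag :: "complex \<Rightarrow> complex" where
  "first_order_lag = (\<lambda>s\<in>closed_rhp. inverse (1 + s))"

definition unit_delay :: "complex \<Rightarrow> complex" where
  "unit_delay = (\<lambda>s\<in>closed_rhp. exp (- s))"

lemma one_plus_nonzero: "s \<in> closed_rhp \<Longrightarrow> 1 + s \<noteq> 0"
  by (auto simp: closed_rhp_def complex_eq_iff)

lemma first_order_lag_in_carrier: "first_order_lag \<in> carrier A0_AP_plus"
proof -
  have "first_order_lag \<in> A0"
    unfolding first_order_lag_def
  proof (rule A0_restrictI)
    show "(\<lambda>s. inverse (1 + s)) holomorphic_on open_rhp"
      using one_plus_nonzero open_rhp_subset by (intro holomorphic_intros) auto
    show "continuous_on closed_rhp (\<lambda>s. inverse (1 + s))"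
      using one_plus_nonzero by (intro continuous_intros) auto
    have "((\<lambda>s::complex. inverse (1 + s)) \<longlongrightarrow> 0) at_infinity"
      by (intro filterlim_compose[OF tendsto_inverse_0] tendsto_add_filterlim_at_infinity[OF tendsto_const] filterlim_ident)
    then show "((\<lambda>s. inverse (1 + s)) \<longlongrightarrow> 0) (inf at_infinity (principal closed_rhp))"
      by (rule tendsto_mono[OF inf_le1])
  qed
  moreover have "first_order_lag = (\<lambda>s\<in>closed_rhp. first_order_lag s + (\<lambda>s\<in>closed_rhp. 0) s)"
    by (auto simp: first_order_lag_def fun_eq_iff)
  ultimately show ?thesis
    unfolding carrier_A0_AP_plus_iff using AP_const by blast
qed

lemma unit_delay_in_carrier: "unit_delay \<in> carrier A0_AP_plus"
  using exp_span_monomial[of 1 1] exp_span_subset_AP AP_subset_carrier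
  by (auto simp: unit_delay_def)

text \<open>Divisibility into \<open>exp (-s)\<close> bounds \<open>1/k\<close> on the imaginary axis only, since \<open>exp s\<close> blows up to
  the right; divisibility into \<open>1/(1 + s)\<close> supplies the moderate growth that excludes this.\<close>

lemma common_divisor_bounded_below:
  assumes k: "k \<in> carrier A0_AP_plus"
    and ka: "k divides\<^bsub>A0_AP_plus\<^esub> first_order_lag" and kb: "k divides\<^bsub>A0_AP_plus\<^esub> unit_delay"
  obtains d where "d > 0" "\<And>s. s \<in> closed_rhp \<Longrightarrow> cmod (k s) \<ge> d"
proof -
  obtain n where n: "n \<in> carrier A0_AP_plus" "first_order_lag = (\<lambda>s\<in>closed_rhp. k s * n s)"
    using ka by (auto simp: factor_def A0_AP_plus_simps)
  obtain m where m: "m \<in> carrier A0_AP_plus" "unit_delay = (\<lambda>s\<in>closed_rhp. k s * m s)"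
    using kb by (auto simp: factor_def A0_AP_plus_simps)
  obtain C where C: "C > 0" "\<And>s. s \<in> closed_rhp \<Longrightarrow> cmod (n s) \<le> C"
    using carrier_bounded[OF n(1)] by blast
  obtain B where B: "B > 0" "\<And>s. s \<in> closed_rhp \<Longrightarrow> cmod (m s) \<le> B"
    using carrier_bounded[OF m(1)] by blast
  have kn: "k s * n s = inverse (1 + s)" and km: "k s * m s = exp (- s)"
    if "s \<in> closed_rhp" for s
    using fun_cong[OF n(2), of s] fun_cong[OF m(2), of s] that
    by (auto simp: first_order_lag_def unit_delay_def)
  have k0: "k s \<noteq> 0" if "s \<in> closed_rhp" for s
    using km[OF that] by auto
  have upper: "cmod (inverse (k s)) \<le> B" if s: "s \<in> closed_rhp" for s
  proof (rule phragmen_lindelof_linear_growth[OF _ _ B(1) _ _ s])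
    show "(\<lambda>s. inverse (k s)) holomorphic_on open_rhp"
      using k0 open_rhp_subset by (intro holomorphic_intros carrier_D[OF k]) auto
    show "continuous_on closed_rhp (\<lambda>s. inverse (k s))"
      using k0 by (intro continuous_intros carrier_D[OF k]) auto
  next
    fix z :: complex assume "Re z = 0"
    then have z: "z \<in> closed_rhp" "cmod (exp z) = 1" by (auto simp: closed_rhp_def)
    have "inverse (k z) = m z * exp z"
      using km[OF z(1)] k0[OF z(1)] by (simp add: field_simps exp_minus)
    then show "cmod (inverse (k z)) \<le> B"
      using z B by (simp add: norm_mult del: norm_exp_eq_Re)
  next
    fix z assume z: "z \<in> closed_rhp"
    have "inverse (k z) = n z * (1 + z)"
      using kn[OF z] k0[OF z] one_plus_nonzero[OF z] by (simp add: field_simps)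
    then show "cmod (inverse (k z)) \<le> C * (1 + cmod z)"
      using C z norm_triangle_ineq[of 1 z] by (auto simp: norm_mult intro!: mult_mono)
  qed
  show ?thesis
  proof (rule that[of "inverse B"])
    fix s assume s: "s \<in> closed_rhp"
    show "inverse B \<le> cmod (k s)"
      using le_imp_inverse_le[OF upper[OF s]] k0[OF s] by (simp add: norm_inverse)
  qed (use B in auto)
qed

lemma one_gcd_first_order_lag_unit_delay:
  "\<one>\<^bsub>A0_AP_plus\<^esub> gcdof\<^bsub>A0_AP_plus\<^esub> first_order_lag unit_delay"
proof -
  interpret domain A0_AP_plus by (rule domain_A0_AP_plus)
  show ?thesis
    unfolding isgcd_def
  proof (intro conjI ballI impI)
    show "\<one>\<^bsub>A0_AP_plus\<^esub> divides\<^bsub>A0_AP_plus\<^esub> first_order_lag"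
      "\<one>\<^bsub>A0_AP_plus\<^esub> divides\<^bsub>A0_AP_plus\<^esub> unit_delay"
      using first_order_lag_in_carrier unit_delay_in_carrier by (auto intro: dividesI)
    fix k assume k: "k \<in> carrier A0_AP_plus"
      and "k divides\<^bsub>A0_AP_plus\<^esub> first_order_lag \<and> k divides\<^bsub>A0_AP_plus\<^esub> unit_delay"
    then obtain d where d: "d > 0" "\<And>s. s \<in> closed_rhp \<Longrightarrow> cmod (k s) \<ge> d"
      using common_divisor_bounded_below by blast
    have "k s \<noteq> 0" if "s \<in> closed_rhp" for s
      using d(1) d(2)[OF that] by auto
    then have "\<one>\<^bsub>A0_AP_plus\<^esub> = k \<otimes>\<^bsub>A0_AP_plus\<^esub> (\<lambda>s\<in>closed_rhp. inverse (k s))"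
      unfolding A0_AP_plus_simps by (intro restrict_ext) simp
    then show "k divides\<^bsub>A0_AP_plus\<^esub> \<one>\<^bsub>A0_AP_plus\<^esub>"
      using carrier_inverse[OF k d] by (auto intro: dividesI)
  qed
qed

text \<open>If \<open>B\<close> and \<open>C\<close> bound \<open>x\<close> and \<open>y\<close>, evaluation at the real point \<open>r = B + C\<close>, where both
  generators are at most \<open>1/(1 + r)\<close>, gives \<open>1 \<le> r/(1 + r)\<close>.\<close>

lemma no_bezout_first_order_lag_unit_delay:
  assumes x: "x \<in> carrier A0_AP_plus" and y: "y \<in> carrier A0_AP_plus"
  shows "\<one>\<^bsub>A0_AP_plus\<^esub> \<noteq>
    x \<otimes>\<^bsub>A0_AP_plus\<^esub> first_order_lag \<oplus>\<^bsub>A0_AP_plus\<^esub> y \<otimes>\<^bsub>A0_AP_plus\<^esub> unit_delay"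
proof
  assume eq: "\<one>\<^bsub>A0_AP_plus\<^esub> =
    x \<otimes>\<^bsub>A0_AP_plus\<^esub> first_order_lag \<oplus>\<^bsub>A0_AP_plus\<^esub> y \<otimes>\<^bsub>A0_AP_plus\<^esub> unit_delay"
  obtain B where B: "B > 0" "\<And>s. s \<in> closed_rhp \<Longrightarrow> cmod (x s) \<le> B"
    using carrier_bounded[OF x] by blast
  obtain C where C: "C > 0" "\<And>s. s \<in> closed_rhp \<Longrightarrow> cmod (y s) \<le> C"
    using carrier_bounded[OF y] by blast
  define r where "r = B + C"
  define s where "s = complex_of_real r"
  have r: "r > 0" using B C by (simp add: r_def)
  then have s: "s \<in> closed_rhp" by (simp add: s_def closed_rhp_def)
  have "1 = x s * inverse (1 + s) + y s * exp (- s)"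
    using fun_cong[OF eq, of s] s by (simp add: A0_AP_plus_simps first_order_lag_def unit_delay_def)
  then have "1 = cmod (x s * inverse (1 + s) + y s * exp (- s))"
    by (metis norm_one)
  also have "\<dots> \<le> B * inverse (1 + r) + C * inverse (1 + r)"
  proof (rule norm_triangle_mono)
    have "cmod (1 + s) = 1 + r"
      using r unfolding s_def by (metis abs_of_pos add_pos_pos norm_of_real of_real_1 of_real_add zero_less_one)
    then show "cmod (x s * inverse (1 + s)) \<le> B * inverse (1 + r)"
      using B s r by (auto simp: norm_mult norm_inverse intro!: mult_right_mono)
    have "inverse (exp r) \<le> inverse (1 + r)"
      using r exp_ge_add_one_self[of r] by (intro le_imp_inverse_le) auto
    then show "cmod (y s * exp (- s)) \<le> C * inverse (1 + r)"
      using C s by (auto simp: norm_mult s_def exp_minus norm_inverse intro!: mult_mono)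
  qed
  also have "\<dots> = r / (1 + r)"
    by (simp add: r_def divide_inverse distrib_right)
  also have "\<dots> < 1" using r by simp
  finally show False by simp
qed

theorem theorem7p1:
  shows "\<not> pre_bezout_domain A0_AP_plus"
proof
  assume "pre_bezout_domain A0_AP_plus"
  then interpret pre_bezout_domain A0_AP_plus .
  show False
    using bezout[OF first_order_lag_in_carrier unit_delay_in_carrier one_closed
        one_gcd_first_order_lag_unit_delay] no_bezout_first_order_lag_unit_delay by blast
qed

end
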